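(* Let $G=(V,A)$ be a directed graph with capacities $u_{ij}\in\mathbb{Q}^+$ for $(i,j)\in A$, and let $(s_k,t_k,d_k)$, $k\in K$, be a finite family of commodities with origin $s_k\in V$, destination $t_k\in V$, $s_k\neq t_k$, and demand $d_k$. If there exists a nonzero-equilibrium pseudo-flow for these data, then the multi-commodity flow problem for these data has no feasible solution (its feasible region is empty).
   Context: For $i\in V$ put $\delta^+(i)=\{j : (i,j)\in A\}$ and $\delta^-(i)=\{j : (j,i)\in A\}$. A pseudo-flow is a family of real numbers $\mathbf f=(f^k_{ij})_{k\in K,(i,j)\in A}$ with $f^k_{ij}\ge 0$ satisfying flow conservation: for all $k\in K$, $i\in V$, $\sum_{j\in\delta^+(i)}f^k_{ij}-\sum_{j\in\delta^-(i)}f^k_{ji}$ equals $d_k$ if $i=s_k$, $-d_k$ if $i=t_k$, and $0$ if $i\in V\setminus\{s_k,t_k\}$. No capacity constraint is imposed. The total flow on an arc is $f_{ij}=\sum_{k\in K}f^k_{ij}$. A feasible solution of the multi-commodity flow problem is a pseudo-flow that also satisfies $\sum_{k\in K}f^k_{ij}\le u_{ij}$ for all $(i,j)\in A$; the feasible region is the set of feasible solutions. The penalty of arc $(i,j)$ is $h(f_{ij})=0$ if $f_{ij}\le u_{ij}$ and $h(f_{ij})=f_{ij}-u_{ij}$ if $f_{ij}>u_{ij}$ (so $h$ depends on the arc through $u_{ij}$). The penalties $h(f_{ij})$ are used as arc weights, so the length of a path is the sum of $h(f_{ij})$ over its arcs. A path $p$ connecting $s_k$ and $t_k$ is called used if there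 exists $s_k$-$t_k$ flow on $p$; otherwise it is called unused. A pseudo-flow is an equilibrium pseudo-flow if for every pair $(s_k,t_k)$: (i) all used paths connecting $s_k$ and $t_k$ have equal and minimum length; (ii) all unused paths connecting $s_k$ and $t_k$ have greater or equal length. An equilibrium pseudo-flow is a zero-equilibrium pseudo-flow if $h(f_{ij})=0$ for all $(i,j)\in A$; otherwise it is a nonzero-equilibrium pseudo-flow.
   Formalization: The equilibrium pseudo-flow is additionally required to be a superposition of nonnegative flows on s_k-t_k paths (used = positive path flow), since a circulation off these paths can overload arcs while a feasible solution exists, making the claim false. *)

theory Defs
  imports Complex_Main "Graph_Theory.Pair_Digraph"
begin

text \<open>
  A commodity flow \<open>f k (i, j)\<close> is only meaningful for \<open>k \<in> K\<close> and \<open>(i, j) \<in> parcs G\<close>;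
  values elsewhere are unconstrained and never used.
\<close>

definition out_nbrs :: "'v pair_pre_digraph \<Rightarrow> 'v \<Rightarrow> 'v set" where
  "out_nbrs G i = {j. (i, j) \<in> parcs G}"

definition in_nbrs :: "'v pair_pre_digraph \<Rightarrow> 'v \<Rightarrow> 'v set" where
  "in_nbrs G i = {j. (j, i) \<in> parcs G}"

definition pseudo_flow ::
  "'v pair_pre_digraph \<Rightarrow> 'k set \<Rightarrow> ('k \<Rightarrow> 'v) \<Rightarrow> ('k \<Rightarrow> 'v) \<Rightarrow> ('k \<Rightarrow> real)
    \<Rightarrow> ('k \<Rightarrow> 'v \<times> 'v \<Rightarrow> real) \<Rightarrow> bool" where
  "pseudo_flow G K s t d f \<longleftrightarrow>
     (\<forall>k\<in>K. \<forall>a\<in>parcs G. 0 \<le> f k a) \<and>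
     (\<forall>k\<in>K. \<forall>i\<in>pverts G.
        (\<Sum>j\<in>out_nbrs G i. f k (i, j)) - (\<Sum>j\<in>in_nbrs G i. f k (j, i)) =
          (if i = s k then d k else if i = t k then - d k else 0))"

definition total_flow :: "'k set \<Rightarrow> ('k \<Rightarrow> 'v \<times> 'v \<Rightarrow> real) \<Rightarrow> 'v \<times> 'v \<Rightarrow> real" where
  "total_flow K f a = (\<Sum>k\<in>K. f k a)"

definition feasible_region ::
  "'v pair_pre_digraph \<Rightarrow> ('v \<times> 'v \<Rightarrow> rat) \<Rightarrow> 'k set \<Rightarrow> ('k \<Rightarrow> 'v) \<Rightarrow> ('k \<Rightarrow> 'v) \<Rightarrow> ('k \<Rightarrow> real)
    \<Rightarrow> ('k \<Rightarrow> 'v \<times> 'v \<Rightarrow> real) set" where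
  "feasible_region G u K s t d =
     {f. pseudo_flow G K s t d f \<and> (\<forall>a\<in>parcs G. total_flow K f a \<le> of_rat (u a))}"

definition penalty ::
  "('v \<times> 'v \<Rightarrow> rat) \<Rightarrow> 'k set \<Rightarrow> ('k \<Rightarrow> 'v \<times> 'v \<Rightarrow> real) \<Rightarrow> 'v \<times> 'v \<Rightarrow> real" where
  "penalty u K f a =
     (if total_flow K f a \<le> of_rat (u a) then 0 else total_flow K f a - of_rat (u a))"

definition paths :: "'v pair_pre_digraph \<Rightarrow> 'v \<Rightarrow> 'v \<Rightarrow> ('v \<times> 'v) awalk set" where
  "paths G v w = {p. pre_digraph.apath (with_proj G) v p w}"

definition path_length ::
  "('v \<times> 'v \<Rightarrow> rat) \<Rightarrow> 'k set \<Rightarrow> ('k \<Rightarrow> 'v \<times> 'v \<Rightarrow> real) \<Rightarrow> ('v \<times> 'v) awalk \<Rightarrow> real" where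
  "path_length u K f p = (\<Sum>a\<leftarrow>p. penalty u K f a)"

text \<open>
  The amount \<open>x k p\<close> is the flow that commodity \<open>k\<close> sends from its origin to its destination
  along the path \<open>p\<close>; the arc flows \<open>f\<close> are the superposition of these path flows.
  In particular \<open>f\<close> contains no circulation detached from the origin-destination paths. Such a
  circulation could overload arcs without affecting the equilibrium conditions, which only
  concern origin-destination paths.
\<close>

definition path_flow ::
  "'v pair_pre_digraph \<Rightarrow> 'k set \<Rightarrow> ('k \<Rightarrow> 'v) \<Rightarrow> ('k \<Rightarrow> 'v)
    \<Rightarrow> ('k \<Rightarrow> 'v \<times> 'v \<Rightarrow> real) \<Rightarrow> ('k \<Rightarrow> ('v \<times> 'v) awalk \<Rightarrow> real) \<Rightarrow> bool" where
  "path_flow G K s t f x \<longleftrightarrow>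
     (\<forall>k\<in>K. \<forall>p\<in>paths G (s k) (t k). 0 \<le> x k p) \<and>
     (\<forall>k\<in>K. \<forall>a\<in>parcs G. f k a = (\<Sum>p | p \<in> paths G (s k) (t k) \<and> a \<in> set p. x k p))"

definition used_paths ::
  "'v pair_pre_digraph \<Rightarrow> ('k \<Rightarrow> 'v) \<Rightarrow> ('k \<Rightarrow> 'v) \<Rightarrow> ('k \<Rightarrow> ('v \<times> 'v) awalk \<Rightarrow> real)
    \<Rightarrow> 'k \<Rightarrow> ('v \<times> 'v) awalk set" where
  "used_paths G s t x k = {p \<in> paths G (s k) (t k). 0 < x k p}"

definition unused_paths ::
  "'v pair_pre_digraph \<Rightarrow> ('k \<Rightarrow> 'v) \<Rightarrow> ('k \<Rightarrow> 'v) \<Rightarrow> ('k \<Rightarrow> ('v \<times> 'v) awalk \<Rightarrow> real)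
    \<Rightarrow> 'k \<Rightarrow> ('v \<times> 'v) awalk set" where
  "unused_paths G s t x k = paths G (s k) (t k) - used_paths G s t x k"

definition equilibrium ::
  "'v pair_pre_digraph \<Rightarrow> ('v \<times> 'v \<Rightarrow> rat) \<Rightarrow> 'k set \<Rightarrow> ('k \<Rightarrow> 'v) \<Rightarrow> ('k \<Rightarrow> 'v) \<Rightarrow> ('k \<Rightarrow> real)
    \<Rightarrow> ('k \<Rightarrow> 'v \<times> 'v \<Rightarrow> real) \<Rightarrow> bool" where
  "equilibrium G u K s t d f \<longleftrightarrow>
     pseudo_flow G K s t d f \<and>
     (\<exists>x. path_flow G K s t f x \<and>
       (\<forall>k\<in>K.
         (\<forall>p\<in>used_paths G s t x k. \<forall>q\<in>used_paths G s t x k.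
            path_length u K f p = path_length u K f q) \<and>
         (\<forall>p\<in>used_paths G s t x k. \<forall>q\<in>paths G (s k) (t k).
            path_length u K f p \<le> path_length u K f q) \<and>
         (\<forall>p\<in>used_paths G s t x k. \<forall>q\<in>unused_paths G s t x k.
            path_length u K f q \<ge> path_length u K f p)))"

definition zero_equilibrium ::
  "'v pair_pre_digraph \<Rightarrow> ('v \<times> 'v \<Rightarrow> rat) \<Rightarrow> 'k set \<Rightarrow> ('k \<Rightarrow> 'v) \<Rightarrow> ('k \<Rightarrow> 'v) \<Rightarrow> ('k \<Rightarrow> real)
    \<Rightarrow> ('k \<Rightarrow> 'v \<times> 'v \<Rightarrow> real) \<Rightarrow> bool" where
  "zero_equilibrium G u K s t d f \<longleftrightarrow>
     equilibrium G u K s t d f \<and> (\<forall>a\<in>parcs G. penalty u K f a = 0)"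

definition nonzero_equilibrium ::
  "'v pair_pre_digraph \<Rightarrow> ('v \<times> 'v \<Rightarrow> rat) \<Rightarrow> 'k set \<Rightarrow> ('k \<Rightarrow> 'v) \<Rightarrow> ('k \<Rightarrow> 'v) \<Rightarrow> ('k \<Rightarrow> real)
    \<Rightarrow> ('k \<Rightarrow> 'v \<times> 'v \<Rightarrow> real) \<Rightarrow> bool" where
  "nonzero_equilibrium G u K s t d f \<longleftrightarrow>
     equilibrium G u K s t d f \<and> \<not> zero_equilibrium G u K s t d f"

end

theory Submission
  imports Defs "Graph_Theory.Shortest_Path"
begin

text \<open>
  Let \<open>w\<close> be the penalties of a nonzero equilibrium \<open>f\<close>, and let \<open>g\<close> be a feasible solution.
  For each commodity the distance from the origin, truncated at the length of a used path, is a
  potential whose increase along every arc is at most the penalty of that arc, with equality on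
  the arcs of used paths. As the weighted sum of the increases of a potential is the
  same for all flows with the same demands, \<open>f k\<close> minimises the \<open>w\<close>-cost among these
  flows, and thus \<open>\<Sum>a. w a * f a \<le> \<Sum>a. w a * g a\<close>. On the other hand
  \<open>g a \<le> u a < f a\<close> wherever \<open>w a > 0\<close>, so the opposite strict inequality holds as well.
\<close>

context pair_fin_digraph
begin

lemma finite_paths: "finite (paths G v w)"
  unfolding paths_def by (simp add: apaths_finite)

lemma apath_distinct:
  assumes "apath v p w"
  shows "distinct p"
proof -
  \<comment> \<open>The tails of the arcs of \<open>p\<close> are its vertices without the last one,
    and these do not repeat.\<close>
  have "distinct (map fst p)"
    using assms awalk_verts_conv[of v p] by (auto simp: apath_def split: if_splits)
  then show ?thesis by (simp add: distinct_map)
qed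

lemma sum_arcs_by_tail:
  "(\<Sum>a\<in>parcs G. h a) = (\<Sum>i\<in>pverts G. \<Sum>j\<in>out_nbrs G i. h (i, j))"
proof -
  have "parcs G = Sigma (pverts G) (out_nbrs G)"
    by (auto simp: out_nbrs_def dest: in_arcsD1)
  moreover have "finite (out_nbrs G i)" for i
    by (rule finite_subset[OF _ pair_finite_verts]) (auto simp: out_nbrs_def dest: in_arcsD2)
  ultimately show ?thesis
    by (simp add: sum.Sigma pair_finite_verts)
qed

lemma sum_arcs_by_head:
  "(\<Sum>a\<in>parcs G. h a) = (\<Sum>i\<in>pverts G. \<Sum>j\<in>in_nbrs G i. h (j, i))"
proof -
  have eq: "parcs G = prod.swap ` Sigma (pverts G) (in_nbrs G)"
    by (force simp: in_nbrs_def dest: in_arcsD2)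
  have "finite (in_nbrs G i)" for i
    by (rule finite_subset[OF _ pair_finite_verts]) (auto simp: in_nbrs_def dest: in_arcsD1)
  then have "(\<Sum>i\<in>pverts G. \<Sum>j\<in>in_nbrs G i. h (j, i))
      = (\<Sum>a\<in>Sigma (pverts G) (in_nbrs G). h (prod.swap a))"
    by (subst sum.Sigma) (auto simp: pair_finite_verts intro: sum.cong)
  also have "\<dots> = (\<Sum>a\<in>parcs G. h a)"
    unfolding eq by (simp add: sum.reindex)
  finally show ?thesis by simp
qed

text \<open>Summation by parts: regrouped at the vertices, the arc sum becomes a sum of divergences
  weighted by \<open>\<phi>\<close>, of which conservation leaves only the two end terms. Hence all
  flows with the same demand share this value.\<close>

lemma pseudo_flow_sum_potential:
  fixes \<phi> :: "'a \<Rightarrow> real"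
  assumes "pseudo_flow G K s t d f" "k \<in> K"
    and "s k \<in> pverts G" "t k \<in> pverts G" "s k \<noteq> t k"
  shows "(\<Sum>a\<in>parcs G. f k a * (\<phi> (snd a) - \<phi> (fst a))) = d k * (\<phi> (t k) - \<phi> (s k))"
proof -
  let ?div = "\<lambda>i. (\<Sum>j\<in>out_nbrs G i. f k (i, j)) - (\<Sum>j\<in>in_nbrs G i. f k (j, i))"
  \<comment> \<open>As \<open>s k \<noteq> t k\<close>, the nested conditional splits into two
    independent indicator terms, each later summed as a single point.\<close>
  have div: "?div i = (if i = s k then d k else 0) - (if i = t k then d k else 0)"
    if "i \<in> pverts G" for i
    using assms that by (simp add: pseudo_flow_def)
  have "(\<Sum>a\<in>parcs G. f k a * (\<phi> (snd a) - \<phi> (fst a)))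
      = (\<Sum>a\<in>parcs G. f k a * \<phi> (snd a)) - (\<Sum>a\<in>parcs G. f k a * \<phi> (fst a))"
    by (simp add: right_diff_distrib sum_subtractf)
  \<comment> \<open>Grouping by heads collects inflow with a plus sign, grouping by tails outflow
    with a minus sign: the opposite of \<open>?div\<close>.\<close>
  also have "\<dots> = - (\<Sum>i\<in>pverts G. ?div i * \<phi> i)"
    by (subst sum_arcs_by_head, subst sum_arcs_by_tail)
      (simp add: left_diff_distrib sum_subtractf sum_distrib_right)
  also have "\<dots> = - (\<Sum>i\<in>pverts G. (if i = s k then d k * \<phi> i else 0)
                              - (if i = t k then d k * \<phi> i else 0))"
    by (intro arg_cong[of _ _ uminus] sum.cong refl) (simp add: div left_diff_distrib)
  also have "\<dots> = d k * (\<phi> (t k) - \<phi> (s k))"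
    using assms pair_finite_verts by (simp add: sum_subtractf right_diff_distrib)
  finally show ?thesis .
qed

text \<open>Double counting of pairs of an arc and a path through it; a path repeats no arc, so each
  arc of it enters once.\<close>

lemma path_flow_sum:
  assumes "path_flow G K s t f x" "k \<in> K"
  shows "(\<Sum>a\<in>parcs G. f k a * c a) = (\<Sum>p\<in>paths G (s k) (t k). x k p * (\<Sum>a\<leftarrow>p. c a))"
proof -
  let ?P = "paths G (s k) (t k)"
  have "(\<Sum>a\<in>parcs G. f k a * c a)
      = (\<Sum>a\<in>parcs G. \<Sum>p | p \<in> ?P \<and> a \<in> set p. x k p * c a)"
    using assms by (intro sum.cong refl) (simp add: path_flow_def sum_distrib_right)
  also have "\<dots> = (\<Sum>p\<in>?P. \<Sum>a | a \<in> parcs G \<and> a \<in> set p. x k p * c a)"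
    by (rule sum.swap_restrict[OF pair_finite_arcs finite_paths])
  also have "\<dots> = (\<Sum>p\<in>?P. x k p * (\<Sum>a\<leftarrow>p. c a))"
  proof (intro sum.cong refl)
    fix p assume "p \<in> ?P"
    then have p: "apath (s k) p (t k)" by (simp add: paths_def)
    then have "{a. a \<in> parcs G \<and> a \<in> set p} = set p"
      by (auto simp: apath_def awalk_def)
    then show "(\<Sum>a | a \<in> parcs G \<and> a \<in> set p. x k p * c a) = x k p * (\<Sum>a\<leftarrow>p. c a)"
      by (simp add: sum_list_distinct_conv_sum_set[OF apath_distinct[OF p]] sum_distrib_left)
  qed
  finally show ?thesis .
qed

lemma sum_list_potential_diff:
  fixes \<phi> :: "'a \<Rightarrow> real"
  assumes "pcas v p w"
  shows "(\<Sum>a\<leftarrow>p. \<phi> (snd a) - \<phi> (fst a)) = \<phi> w - \<phi> v"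
  using assms by (induction v p w rule: pcas.induct) auto

lemma distance_potential_exists:
  fixes c :: "'a \<times> 'a \<Rightarrow> real"
  assumes nonneg: "\<And>a. a \<in> parcs G \<Longrightarrow> 0 \<le> c a"
    and p: "p \<in> paths G v w"
    and shortest: "\<And>q. q \<in> paths G v w \<Longrightarrow> (\<Sum>a\<leftarrow>p. c a) \<le> (\<Sum>a\<leftarrow>q. c a)"
  obtains \<phi> :: "'a \<Rightarrow> real"
  where "\<And>a. a \<in> parcs G \<Longrightarrow> \<phi> (snd a) - \<phi> (fst a) \<le> c a"
    and "\<phi> w - \<phi> v = (\<Sum>a\<leftarrow>p. c a)"
proof -
  define L where "L = (\<Sum>a\<leftarrow>p. c a)"
  have p: "awalk v p w" using p by (simp add: paths_def apath_def)
  then have L: "0 \<le> L"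
    using pos_cost_pos_awalk_cost[OF p] nonneg by (simp add: L_def awalk_cost_def)
  have mu_nonneg: "0 \<le> \<mu> c i j" for i j
    unfolding \<mu>_def using pos_cost_pos_awalk_cost nonneg by (auto intro!: INF_greatest)
  \<comment> \<open>The cap \<open>L\<close> makes the potential finite at vertices unreachable from
    \<open>v\<close>, where the distance is infinite.\<close>
  define \<phi> where "\<phi> i = real_of_ereal (min (ereal L) (\<mu> c v i))" for i
  have phi: "ereal (\<phi> i) = min (ereal L) (\<mu> c v i)" for i
    using mu_nonneg[of v i] L unfolding \<phi>_def by (cases "\<mu> c v i") (auto simp: min_def)
  have "\<phi> (snd a) \<le> \<phi> (fst a) + c a" if a: "a \<in> parcs G" for a
  proof -
    have "\<mu> c v (snd a) \<le> \<mu> c v (fst a) + ereal (c a)"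
      using pos_cost_mu_triangle[of c a "fst a" "snd a" v] nonneg a
      by (auto simp: arc_to_ends_def)
    \<comment> \<open>If the distance of the tail is at least \<open>L\<close>, the right side is at
      least \<open>L\<close> because \<open>0 \<le> c a\<close>; otherwise the cap is inactive at
      the tail and the triangle inequality suffices.\<close>
    then have "ereal (\<phi> (snd a)) \<le> ereal (\<phi> (fst a)) + ereal (c a)"
      unfolding phi using nonneg[OF a] mu_nonneg[of v "snd a"]
      by (cases "\<mu> c v (fst a)"; cases "\<mu> c v (snd a)") (auto simp: min_def)
    then show ?thesis by simp
  qed
  moreover have "\<phi> w = L"
  proof -
    \<comment> \<open>With nonnegative weights the distance is attained on a simple path, to which
      \<open>shortest\<close> applies.\<close>
    obtain q where "apath v q w" "\<mu> c v w = awalk_cost c q"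
      using min_cost_awalk[of v w c] p nonneg by (auto simp: reachable_awalk)
    then have "ereal L \<le> \<mu> c v w"
      using shortest[of q] by (simp add: L_def paths_def awalk_cost_def)
    then show ?thesis by (simp add: \<phi>_def min_def)
  qed
  moreover have "\<phi> v = 0"
  proof -
    have "awalk v [] v" using p by (simp add: awalk_def)
    then have "\<mu> c v v \<le> 0" using min_cost_le_walk_cost[of v "[]" v c] by (simp add: zero_ereal_def)
    then have "\<mu> c v v = 0" using mu_nonneg[of v v] by simp
    then show ?thesis using L by (simp add: \<phi>_def min_def)
  qed
  ultimately show ?thesis
    using that[of \<phi>] by (force simp: L_def)
qed

text \<open>This is linear programming duality for one commodity: the potential is a dual solution
  certifying that \<open>f k\<close> is optimal.\<close>

lemma equilibrium_commodity_cost_le: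
  assumes eq: "equilibrium G u K s t d f"
    and g: "pseudo_flow G K s t d g"
    and k: "k \<in> K" "s k \<in> pverts G" "t k \<in> pverts G" "s k \<noteq> t k"
  shows "(\<Sum>a\<in>parcs G. f k a * penalty u K f a) \<le> (\<Sum>a\<in>parcs G. g k a * penalty u K f a)"
proof -
  let ?w = "penalty u K f" and ?P = "paths G (s k) (t k)"
  have w: "0 \<le> ?w a" for a by (simp add: penalty_def)
  have g_nonneg: "0 \<le> g k a" if "a \<in> parcs G" for a
    using g k that by (simp add: pseudo_flow_def)
  have f: "pseudo_flow G K s t d f" using eq by (simp add: equilibrium_def)
  obtain x where x: "path_flow G K s t f x"
    and shortest: "\<And>p q. p \<in> used_paths G s t x k \<Longrightarrow> q \<in> ?P \<Longrightarrow> path_length u K f p \<le> path_length u K f q"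
    using eq k unfolding equilibrium_def by blast
  have x_nonneg: "0 \<le> x k p" if "p \<in> ?P" for p
    using x k that by (simp add: path_flow_def)
  show ?thesis
  proof (cases "used_paths G s t x k = {}")
    case True
    \<comment> \<open>Without used paths the cost of \<open>f k\<close> is zero, and that of
      \<open>g k\<close> is nonnegative.\<close>
    then have "x k p = 0" if "p \<in> ?P" for p
      using x_nonneg[OF that] that by (force simp: used_paths_def)
    then have "(\<Sum>a\<in>parcs G. f k a * ?w a) = 0"
      by (simp add: path_flow_sum[OF x k(1)])
    then show ?thesis
      using w g_nonneg by (simp add: sum_nonneg)
  next
    case False
    then obtain p where p: "p \<in> used_paths G s t x k" by blast
    then have "p \<in> ?P" by (simp add: used_paths_def)
    then obtain \<phi> where \<phi>: "\<And>a. a \<in> parcs G \<Longrightarrow> \<phi> (snd a) - \<phi> (fst a) \<le> ?w a"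
      and \<phi>_ends: "\<phi> (t k) - \<phi> (s k) = path_length u K f p"
      using distance_potential_exists[of ?w p "s k" "t k"] w shortest[OF p]
      by (auto simp: path_length_def)
    have *: "x k q * (\<Sum>a\<leftarrow>q. ?w a) = x k q * (\<Sum>a\<leftarrow>q. \<phi> (snd a) - \<phi> (fst a))"
      if q: "q \<in> ?P" for q
    proof (cases "q \<in> used_paths G s t x k")
      case True
      have "path_length u K f q = path_length u K f p"
        using shortest[OF p q] shortest[OF True \<open>p \<in> ?P\<close>] by simp
      moreover have "pcas (s k) q (t k)"
        using q by (simp add: paths_def apath_def awalk_def)
      ultimately show ?thesis
        by (simp add: sum_list_potential_diff \<phi>_ends path_length_def)
    next
      case False
      then show ?thesis using q x_nonneg[OF q] by (simp add: used_paths_def)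
    qed
    have "(\<Sum>a\<in>parcs G. f k a * ?w a) = (\<Sum>a\<in>parcs G. f k a * (\<phi> (snd a) - \<phi> (fst a)))"
      by (simp add: path_flow_sum[OF x k(1)] * cong: sum.cong)
    also have "\<dots> = (\<Sum>a\<in>parcs G. g k a * (\<phi> (snd a) - \<phi> (fst a)))"
      by (simp only: pseudo_flow_sum_potential[OF f k] pseudo_flow_sum_potential[OF g k])
    also have "\<dots> \<le> (\<Sum>a\<in>parcs G. g k a * ?w a)"
      by (intro sum_mono mult_left_mono \<phi> g_nonneg)
    finally show ?thesis .
  qed
qed

end

theorem theorem2:
  fixes G :: "'v pair_pre_digraph"
    and u :: "'v \<times> 'v \<Rightarrow> rat"
    and K :: "'k set"
    and s t :: "'k \<Rightarrow> 'v"
    and d :: "'k \<Rightarrow> real"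
  assumes "pair_fin_digraph G"
    and "\<forall>a\<in>parcs G. 0 < u a"
    and "finite K"
    and "\<forall>k\<in>K. s k \<in> pverts G \<and> t k \<in> pverts G \<and> s k \<noteq> t k"
    and "\<exists>f. nonzero_equilibrium G u K s t d f"
  shows "feasible_region G u K s t d = {}"
proof (rule equals0I)
  interpret pair_fin_digraph G by fact
  fix g assume g: "g \<in> feasible_region G u K s t d"
  obtain f where eq: "equilibrium G u K s t d f"
    and nonzero: "\<exists>a\<in>parcs G. penalty u K f a \<noteq> 0"
    using assms(5) by (auto simp: nonzero_equilibrium_def zero_equilibrium_def)
  let ?w = "penalty u K f"
  \<comment> \<open>Exchanging the sums reduces the comparison of total costs to single
    commodities.\<close>
  have total: "(\<Sum>a\<in>parcs G. total_flow K h a * ?w a) = (\<Sum>k\<in>K. \<Sum>a\<in>parcs G. h k a * ?w a)" for h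
    unfolding total_flow_def sum_distrib_right by (rule sum.swap)
  have "(\<Sum>a\<in>parcs G. total_flow K f a * ?w a) \<le> (\<Sum>a\<in>parcs G. total_flow K g a * ?w a)"
    unfolding total using assms(4) g
    by (intro sum_mono equilibrium_commodity_cost_le[OF eq]) (auto simp: feasible_region_def)
  moreover have "(\<Sum>a\<in>parcs G. total_flow K g a * ?w a) < (\<Sum>a\<in>parcs G. total_flow K f a * ?w a)"
  proof (rule sum_strict_mono_ex1[OF pair_finite_arcs])
    have le: "total_flow K g a \<le> of_rat (u a)" if "a \<in> parcs G" for a
      using g that by (simp add: feasible_region_def)
    show "\<forall>a\<in>parcs G. total_flow K g a * ?w a \<le> total_flow K f a * ?w a"
      using le by (force simp: penalty_def intro: mult_right_mono)
    \<comment> \<open>An arc of nonzero penalty is overloaded by \<open>f\<close> but not by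
      \<open>g\<close>, and its weight is positive.\<close>
    show "\<exists>a\<in>parcs G. total_flow K g a * ?w a < total_flow K f a * ?w a"
      using nonzero le by (force simp: penalty_def intro: mult_strict_right_mono split: if_splits)
  qed
  ultimately show False by simp
qed

end
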